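(* Let $K$ be an infinite field of characteristic different from $2$ and $3$, and let $N$ be a commutative (not necessarily associative) algebra over $K$ satisfying the identity $x^3=0$. If $N$ satisfies the descending chain condition on ideals, then $N$ is finite-dimensional over $K$.
   Context: Algebras over $K$ are not assumed associative, unital or finite-dimensional. In a commutative algebra, $x^3$ denotes $x^2x=xx^2$. The descending chain condition on ideals means that every descending sequence of ideals is stationary. *)

theory Defs
  imports Complex_Main "HOL-Computational_Algebra.Computational_Algebra"
begin

text \<open>Algebras need not be associative, unital or finite-dimensional; the
  underlying vector space is the whole type \<open>'n\<close>.\<close>

locale nonassoc_algebra = vector_space scale
  for scale :: "'k::field \<Rightarrow> 'n::ab_group_add \<Rightarrow> 'n" +
  fixes mult :: "'n \<Rightarrow> 'n \<Rightarrow> 'n"  (infixl \<open>\<bullet>\<close> 70)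
  assumes mult_add_left: "(x + y) \<bullet> z = x \<bullet> z + y \<bullet> z"
    and mult_add_right: "x \<bullet> (y + z) = x \<bullet> y + x \<bullet> z"
    and mult_scale_left: "scale a x \<bullet> y = scale a (x \<bullet> y)"
    and mult_scale_right: "x \<bullet> scale a y = scale a (x \<bullet> y)"
begin

definition algebra_ideal :: "'n set \<Rightarrow> bool" where
  "algebra_ideal I \<longleftrightarrow> subspace I \<and> (\<forall>x\<in>I. \<forall>y. y \<bullet> x \<in> I \<and> x \<bullet> y \<in> I)"

definition dcc_ideals :: bool where
  "dcc_ideals \<longleftrightarrow>
     (\<forall>I :: nat \<Rightarrow> 'n set. (\<forall>n. algebra_ideal (I n)) \<and> decseq I
        \<longrightarrow> (\<exists>m. \<forall>n\<ge>m. I n = I m))"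

end

locale commutative_nonassoc_algebra = nonassoc_algebra scale mult
  for scale :: "'k::field \<Rightarrow> 'n::ab_group_add \<Rightarrow> 'n"
    and mult :: "'n \<Rightarrow> 'n \<Rightarrow> 'n"  (infixl \<open>\<bullet>\<close> 70) +
  assumes mult_commute: "x \<bullet> y = y \<bullet> x"

end

theory Submission
  imports Defs
begin

text \<open>
  Write \<open>X\<close>, \<open>Y\<close> for multiplication by \<open>x\<close>, \<open>y\<close>. Polarising \<open>x\<^sup>3 = 0\<close> gives the Jacobi identity
  \<open>(xy)z + (yz)x + (zx)y = 0\<close>. So multiplication by \<open>xy\<close> is \<open>- (XY + YX)\<close>, products of ideals are
  ideals, and \<open>X\<^sup>3 = 0\<close> for every multiplication operator \<open>X\<close>. Two facts carry the proof.

  An ideal \<open>I\<close> with \<open>I = II\<close> is zero (\<open>idempotent_subspace_zero\<close>). Relations between words of degree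
  two in each of \<open>X\<close> and \<open>Y\<close> show that the derivation \<open>D = XY - YX\<close> satisfies \<open>D\<^sup>2 = -3 R\<^sup>2\<close>, where \<open>R\<close>
  is multiplication by \<open>xy\<close>. This makes \<open>D\<^sup>3\<close> anticommute with all multiplications and kill
  every product \<open>(ab)c\<close>, in particular every element of \<open>I\<close>. As \<open>D\<^sup>3 = 6 XXYYXY\<close>, the
  word \<open>XXYYXY\<close> vanishes on \<open>I\<close>. Polarising such an identity in one variable, feeding in the
  element \<open>z\<close> of \<open>I\<close> on which the word acts, and using that squares span \<open>I\<close>, shortens the word: also
  \<open>XXYYX\<close> and then \<open>XXYY\<close> vanish on \<open>I\<close>. The last one says \<open>I(II) = 0\<close>, that is \<open>I = 0\<close>.

  The chain condition supplies an idempotent ideal of finite codimension. Descend from \<open>N\<close> by ideals,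
  passing from \<open>Q\<close> to \<open>H\<close> if \<open>Q = H + Kb\<close> and \<open>b\<^sup>2 \<in> H\<close>, and let \<open>I\<close> be a minimal ideal that can be reached.
  If \<open>IN\<close> were smaller than \<open>I\<close>, then every hyperplane of \<open>I\<close> containing \<open>IN\<close> could be reached as well;
  hence \<open>I = IN\<close>. From \<open>I = IQ\<close> follows \<open>I = (IQ)Q\<close>, which lies in \<open>IH\<close> because
  \<open>(xb)b = - x(b\<^sup>2) / 2\<close>. So \<open>I = IQ\<close> is inherited along the flag down to \<open>I = II\<close>; thus \<open>I = 0\<close> has
  finite codimension.
\<close>

section \<open>Hyperplanes and minimal ideals\<close>

context vector_space
begin

lemma hyperplane_avoiding:
  assumes "subspace S" "subspace I" "S \<subseteq> I" "b \<in> I" "b \<notin> S"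
  shows "\<exists>H. subspace H \<and> S \<subseteq> H \<and> H \<subset> I \<and> I = span (insert b H)"
proof -
  obtain C where C: "C \<subseteq> S" "independent C" "S \<subseteq> span C"
    using maximal_independent_subset[of S] by blast
  have "span C \<subseteq> S" using C(1) assms(1) by (rule span_minimal)
  with assms(5) have "b \<notin> span C" by blast
  then have "independent (insert b C)" using C(2) by (rule independent_insertI)
  then obtain B where B: "insert b C \<subseteq> B" "B \<subseteq> I" "independent B" "I \<subseteq> span B"
    using maximal_independent_subset_extend[of "insert b C" I] C(1) assms by blast
  let ?H = "span (B - {b})"
  have "b \<notin> ?H" using B(1,3) unfolding dependent_def by blast
  have CB: "C \<subseteq> B - {b}" using B(1) \<open>b \<notin> span C\<close> span_base by blast
  have HI: "?H \<subseteq> I" using B(2) assms(2) by (intro span_minimal) auto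
  have "span B \<subseteq> span (insert b ?H)"
    by (rule span_minimal) (auto intro: span_base)
  moreover have "span (insert b ?H) \<subseteq> I"
    using HI assms by (intro span_minimal) auto
  ultimately have "I = span (insert b ?H)" using B(4) by blast
  moreover have "S \<subseteq> ?H" using C(3) span_mono[OF CB] by blast
  ultimately show ?thesis using HI \<open>b \<notin> ?H\<close> assms(4) by (intro exI[of _ ?H]) auto
qed

end

context nonassoc_algebra
begin

lemma dcc_minimal:
  assumes dcc: dcc_ideals and "P I0" and ideal: "\<And>I. P I \<Longrightarrow> algebra_ideal I"
  shows "\<exists>I. P I \<and> (\<forall>J. P J \<longrightarrow> \<not> J \<subset> I)"
proof (rule ccontr)
  assume contra: "\<not> ?thesis"
  have smaller: "\<exists>J. P J \<and> J \<subset> I" if "P I" for I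
  proof (rule ccontr)
    assume "\<not> (\<exists>J. P J \<and> J \<subset> I)"
    with that have "P I \<and> (\<forall>J. P J \<longrightarrow> \<not> J \<subset> I)" by simp
    then have "\<exists>I. P I \<and> (\<forall>J. P J \<longrightarrow> \<not> J \<subset> I)" by (rule exI[of _ I])
    with contra show False by (rule notE)
  qed
  have "\<exists>f. \<forall>n::nat. P (f n) \<and> f (Suc n) \<subset> f n"
  proof (rule dependent_nat_choice[of "\<lambda>_. P" "\<lambda>_ I J. J \<subset> I"])
    show "\<exists>I. P I" using \<open>P I0\<close> by blast
  next
    fix I :: "'n set" and n :: nat
    assume "P I"
    then show "\<exists>J. P J \<and> J \<subset> I" by (rule smaller)
  qed
  then obtain f :: "nat \<Rightarrow> 'n set" where f: "\<And>n. P (f n)" "\<And>n. f (Suc n) \<subset> f n" by blast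
  have "decseq f" using f(2) by (intro decseq_SucI psubset_imp_subset)
  moreover have "\<forall>n. algebra_ideal (f n)" using f(1) ideal by simp
  ultimately have "\<exists>m. \<forall>n\<ge>m. f n = f m"
    by (intro dcc[unfolded dcc_ideals_def, THEN spec[of _ f], THEN mp] conjI)
  then obtain m where stationary: "\<forall>n\<ge>m. f n = f m" ..
  have "f (Suc m) = f m" using le_SucI[OF order_refl] by (rule stationary[rule_format])
  with f(2)[of m] show False by simp
qed

end

section \<open>Commutative algebras with vanishing cubes\<close>

locale cubic_nil_algebra = commutative_nonassoc_algebra scale mult
  for scale :: "'k::field \<Rightarrow> 'n::ab_group_add \<Rightarrow> 'n"
    and mult :: "'n \<Rightarrow> 'n \<Rightarrow> 'n"  (infixl \<open>\<bullet>\<close> 70) +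
  assumes cube_zero: "x \<bullet> x \<bullet> x = 0"
    and two_nonzero: "(2::'k) \<noteq> 0"
    and three_nonzero: "(3::'k) \<noteq> 0"
begin

lemma double_zero_imp_zero: "(v::'n) + v = 0 \<Longrightarrow> v = 0"
  using scale_left_distrib[of 1 1 v] two_nonzero scale_eq_0_iff[of 2 v] by simp

lemma triple_zero_imp_zero: "(v::'n) + v + v = 0 \<Longrightarrow> v = 0"
  using scale_left_distrib[of 1 2 v] scale_left_distrib[of 1 1 v] three_nonzero scale_eq_0_iff[of 3 v]
  by (simp add: add.assoc)

lemma double_cancel: "(u::'n) + u = v + v \<Longrightarrow> u = v"
  using double_zero_imp_zero[of "u - v"] by (simp add: algebra_simps)

lemma mult_zero [simp]: "x \<bullet> 0 = 0" "0 \<bullet> x = 0"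
  using mult_add_right[of x 0 0] mult_add_left[of 0 0 x] by simp_all

lemma mult_minus [simp]: "x \<bullet> (- y) = - (x \<bullet> y)" "(- x) \<bullet> y = - (x \<bullet> y)"
  using mult_add_right[of x y "- y"] mult_add_left[of x "- x" y]
  by (simp_all add: eq_neg_iff_add_eq_0 add.commute)

lemma mult_diff: "x \<bullet> (y - z) = x \<bullet> y - x \<bullet> z" "(x - y) \<bullet> z = x \<bullet> z - y \<bullet> z"
  using mult_add_right[of x y "- z"] mult_add_left[of x "- y" z] by simp_all

lemmas mult_linear = mult_add_left mult_add_right mult_diff

text \<open>The part of \<open>(x + y)\<^sup>3 = 0\<close> that is linear in \<open>y\<close>; subtracting the same identity for \<open>- y\<close>
  isolates it twice.\<close>

lemma square_mult: "x \<bullet> x \<bullet> y = - (x \<bullet> (x \<bullet> y)) - x \<bullet> (x \<bullet> y)"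
proof -
  have "(x + y) \<bullet> (x + y) \<bullet> (x + y) = 0" "(x - y) \<bullet> (x - y) \<bullet> (x - y) = 0"
    by (rule cube_zero)+
  then have "(x + y) \<bullet> (x + y) \<bullet> (x + y) - (x - y) \<bullet> (x - y) \<bullet> (x - y) = 0"
    by simp
  then have "(x \<bullet> x \<bullet> y + x \<bullet> (x \<bullet> y) + x \<bullet> (x \<bullet> y)) + (x \<bullet> x \<bullet> y + x \<bullet> (x \<bullet> y) + x \<bullet> (x \<bullet> y)) = 0"
    using cube_zero[of x] cube_zero[of y]
    by (simp add: mult_linear mult_commute[of y x] mult_commute[of "x \<bullet> y" x] mult_commute[of "x \<bullet> y" y] mult_commute[of "y \<bullet> y" x]
        mult_commute[of "x \<bullet> x" x] mult_commute[of "y \<bullet> y" y] algebra_simps)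
  from double_zero_imp_zero[OF this] show ?thesis
    by (simp add: algebra_simps eq_neg_iff_add_eq_0)
qed

text \<open>The Jacobi identity, read as a rule that expresses multiplication by a product through
  multiplications by its factors. It turns every product into right-nested words.\<close>

lemma product_mult: "x \<bullet> y \<bullet> z = - (x \<bullet> (y \<bullet> z)) - y \<bullet> (x \<bullet> z)"
proof -
  have "(x + y) \<bullet> (x + y) \<bullet> z = - ((x + y) \<bullet> ((x + y) \<bullet> z)) - (x + y) \<bullet> ((x + y) \<bullet> z)"
    by (rule square_mult)
  then have "(x \<bullet> y \<bullet> z + x \<bullet> (y \<bullet> z) + y \<bullet> (x \<bullet> z)) + (x \<bullet> y \<bullet> z + x \<bullet> (y \<bullet> z) + y \<bullet> (x \<bullet> z)) = 0"
    by (simp add: mult_linear square_mult[of x z] square_mult[of y z] mult_commute[of y x] algebra_simps)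
  from double_zero_imp_zero[OF this] show ?thesis
    by (simp add: algebra_simps eq_neg_iff_add_eq_0)
qed

text \<open>The Jacobi identity again: multiplications are antiderivations.\<close>

lemma mult_product: "z \<bullet> (x \<bullet> y) = - (z \<bullet> x \<bullet> y) - x \<bullet> (z \<bullet> y)"
  by (simp add: product_mult[of z x y])

text \<open>Expanding \<open>(x\<^sup>2 x) z = 0\<close> by the Jacobi identity leaves \<open>4 XXX z\<close>.\<close>

lemma mult_cube_zero: "x \<bullet> (x \<bullet> (x \<bullet> z)) = 0"
proof -
  define c where "c = x \<bullet> (x \<bullet> (x \<bullet> z))"
  have "0 = - (x \<bullet> x \<bullet> (x \<bullet> z)) - x \<bullet> (x \<bullet> x \<bullet> z)"
    using product_mult[of "x \<bullet> x" x z] by (simp add: cube_zero)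
  also have "\<dots> = (c + c) + (c + c)"
    by (simp add: c_def square_mult mult_linear)
  finally show ?thesis
    using double_zero_imp_zero c_def by metis
qed

lemma mult_cube_polar: "x \<bullet> (x \<bullet> (y \<bullet> z)) + x \<bullet> (y \<bullet> (x \<bullet> z)) + y \<bullet> (x \<bullet> (x \<bullet> z)) = 0"
proof (rule double_zero_imp_zero)
  have "(x + y) \<bullet> ((x + y) \<bullet> ((x + y) \<bullet> z)) - (x - y) \<bullet> ((x - y) \<bullet> ((x - y) \<bullet> z)) = 0"
    by (simp only: mult_cube_zero diff_self)
  then show "x \<bullet> (x \<bullet> (y \<bullet> z)) + x \<bullet> (y \<bullet> (x \<bullet> z)) + y \<bullet> (x \<bullet> (x \<bullet> z))
    + (x \<bullet> (x \<bullet> (y \<bullet> z)) + x \<bullet> (y \<bullet> (x \<bullet> z)) + y \<bullet> (x \<bullet> (x \<bullet> z))) = 0"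
    using mult_cube_zero[of x z] mult_cube_zero[of y z] by (simp add: mult_linear algebra_simps)
qed

text \<open>The six words in two letters \<open>X\<close> and two letters \<open>Y\<close> reduce to two of them. Besides the polarised
  cube of \<open>X\<close> and \<open>Y\<close>, multiplied by one more letter, this needs the polarised cube of \<open>X\<close> and the
  multiplication by \<open>y\<^sup>2\<close>, which is \<open>-2 YY\<close>.\<close>

lemma words_2_2:
  shows "y \<bullet> (y \<bullet> (x \<bullet> (x \<bullet> z))) = x \<bullet> (y \<bullet> (x \<bullet> (y \<bullet> z)))"
    and "y \<bullet> (x \<bullet> (x \<bullet> (y \<bullet> z))) = x \<bullet> (y \<bullet> (y \<bullet> (x \<bullet> z)))"
    and "x \<bullet> (y \<bullet> (y \<bullet> (x \<bullet> z))) = - (x \<bullet> (x \<bullet> (y \<bullet> (y \<bullet> z)))) - x \<bullet> (y \<bullet> (x \<bullet> (y \<bullet> z)))"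
proof -
  let ?xxyy = "x \<bullet> (x \<bullet> (y \<bullet> (y \<bullet> z)))" and ?xyxy = "x \<bullet> (y \<bullet> (x \<bullet> (y \<bullet> z)))"
    and ?xyyx = "x \<bullet> (y \<bullet> (y \<bullet> (x \<bullet> z)))" and ?yxxy = "y \<bullet> (x \<bullet> (x \<bullet> (y \<bullet> z)))"
    and ?yyxx = "y \<bullet> (y \<bullet> (x \<bullet> (x \<bullet> z)))"
  have a: "?xxyy + ?xyxy + ?yxxy = 0" by (rule mult_cube_polar)
  have d: "?xyyx + ?xyxy + ?xxyy = 0"
    using arg_cong[OF mult_cube_polar[of y x z], of "\<lambda>t. x \<bullet> t"] by (simp add: mult_linear algebra_simps)
  have "(?xxyy + ?xyyx + ?yyxx) + (?xxyy + ?xyyx + ?yyxx) = 0"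
    using mult_cube_polar[of x "y \<bullet> y" z] by (simp add: square_mult mult_linear algebra_simps neg_eq_iff_add_eq_0)
  from double_zero_imp_zero[OF this] have e: "?xxyy + ?xyyx + ?yyxx = 0" .
  have "(?xxyy + ?xyyx) + ?yyxx = (?xxyy + ?xyyx) + ?xyxy"
    using d by (simp only: e) (simp add: add.assoc add.commute add.left_commute)
  then show "?yyxx = ?xyxy" by (rule add_left_imp_eq)
  have "(?xxyy + ?xyxy) + ?yxxy = (?xxyy + ?xyxy) + ?xyyx"
    using d by (simp only: a) (simp add: add.assoc add.commute add.left_commute)
  then show "?yxxy = ?xyyx" by (rule add_left_imp_eq)
  show "?xyyx = - ?xxyy - ?xyxy" using d by (simp add: eq_diff_eq eq_neg_iff_add_eq_0)
qed

section \<open>Cubes of inner derivations\<close>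

definition comm :: "'n \<Rightarrow> 'n \<Rightarrow> 'n \<Rightarrow> 'n" where
  "comm x y z = x \<bullet> (y \<bullet> z) - y \<bullet> (x \<bullet> z)"

text \<open>The commutator of two antiderivations is a derivation.\<close>

lemma comm_derivation: "comm x y (z \<bullet> a) = comm x y z \<bullet> a + z \<bullet> comm x y a"
  by (simp add: comm_def mult_linear mult_product[of _ z a] mult_product[of x "y \<bullet> z" a]
      mult_product[of y "x \<bullet> z" a] mult_product[of x z "y \<bullet> a"] mult_product[of y z "x \<bullet> a"])

lemma comm_add: "comm x y (u + v) = comm x y u + comm x y v"
  by (simp add: comm_def mult_linear)

lemma comm_minus: "comm x y (- u) = - comm x y u"
  by (simp add: comm_def)

lemma comm_diff: "comm x y (u - v) = comm x y u - comm x y v"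
  by (simp add: comm_def mult_linear)

lemma comm_square_words:
  fixes x y z
  defines "w \<equiv> x \<bullet> (y \<bullet> (x \<bullet> (y \<bullet> z))) + y \<bullet> (x \<bullet> (y \<bullet> (x \<bullet> z)))"
  shows "comm x y (comm x y z) = w + w + w"
  unfolding w_def
  using words_2_2(3)[where x = x and y = y and z = z] words_2_2(1)[where x = y and y = x and z = z]
  by (simp add: comm_def mult_linear words_2_2(2)[where x = x and y = y])

text \<open>With \<open>D\<close> for the commutator and \<open>R\<close> for multiplication by \<open>xy\<close>, this is \<open>D\<^sup>2 = -3 R\<^sup>2\<close>. It gives
  \<open>D\<^sup>2\<close> the behaviour of a square of a multiplication.\<close>

lemma comm_comm: "comm x y (comm x y z) = - (x \<bullet> y \<bullet> (x \<bullet> y \<bullet> z)) - x \<bullet> y \<bullet> (x \<bullet> y \<bullet> z) - x \<bullet> y \<bullet> (x \<bullet> y \<bullet> z)"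
  using words_2_2(3)[where x = x and y = y and z = z] words_2_2(1)[where x = y and y = x and z = z]
  by (simp add: comm_def product_mult mult_linear words_2_2(2)[where x = x and y = y])

text \<open>Multiplication by \<open>r\<^sup>2\<close> is \<open>-2\<close> times the square of multiplication by \<open>r\<close>, and it is an
  antiderivation.\<close>

lemma square_antiderivation: "r \<bullet> (r \<bullet> z) \<bullet> a + z \<bullet> (r \<bullet> (r \<bullet> a)) = - (r \<bullet> (r \<bullet> (z \<bullet> a)))"
proof -
  let ?t = "r \<bullet> (r \<bullet> z) \<bullet> a + z \<bullet> (r \<bullet> (r \<bullet> a)) + r \<bullet> (r \<bullet> (z \<bullet> a))"
  have "?t + ?t = 0"
    using mult_product[of "r \<bullet> r" z a]
    by (simp add: square_mult mult_linear algebra_simps neg_eq_iff_add_eq_0)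
  from double_zero_imp_zero[OF this] show ?thesis
    by (simp add: eq_neg_iff_add_eq_0)
qed

text \<open>Applying the antiderivation \<open>r\<close> twice to \<open>za\<close> produces the mixed term twice; the other terms are
  known from the previous lemma.\<close>

lemma mult_pair: "(r \<bullet> z) \<bullet> (r \<bullet> a) = r \<bullet> (r \<bullet> (z \<bullet> a))"
proof (rule double_cancel)
  have "r \<bullet> (r \<bullet> (z \<bullet> a)) = (r \<bullet> (r \<bullet> z) \<bullet> a + z \<bullet> (r \<bullet> (r \<bullet> a))) + ((r \<bullet> z) \<bullet> (r \<bullet> a) + (r \<bullet> z) \<bullet> (r \<bullet> a))"
    by (simp add: mult_product[of r z a] mult_product[of r "r \<bullet> z" a] mult_product[of r z "r \<bullet> a"] mult_linear)
  then have "r \<bullet> (r \<bullet> (z \<bullet> a)) = ((r \<bullet> z) \<bullet> (r \<bullet> a) + (r \<bullet> z) \<bullet> (r \<bullet> a)) - r \<bullet> (r \<bullet> (z \<bullet> a))"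
    by (simp add: square_antiderivation)
  then show "(r \<bullet> z) \<bullet> (r \<bullet> a) + (r \<bullet> z) \<bullet> (r \<bullet> a) = r \<bullet> (r \<bullet> (z \<bullet> a)) + r \<bullet> (r \<bullet> (z \<bullet> a))"
    unfolding eq_diff_eq by simp
qed

lemma comm_square_antiderivation:
  "comm x y (comm x y z) \<bullet> a + z \<bullet> comm x y (comm x y a) = - comm x y (comm x y (z \<bullet> a))"
  unfolding comm_comm
  using square_antiderivation[of "x \<bullet> y" z a] by (simp add: mult_linear algebra_simps)

text \<open>The argument of \<open>mult_pair\<close>, now for a derivation in place of an antiderivation: the sign of the
  mixed term is the same.\<close>

lemma comm_pair: "comm x y z \<bullet> comm x y a = comm x y (comm x y (z \<bullet> a))"
proof (rule double_cancel)
  have "comm x y (comm x y (z \<bullet> a)) = (comm x y (comm x y z) \<bullet> a + z \<bullet> comm x y (comm x y a))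
      + (comm x y z \<bullet> comm x y a + comm x y z \<bullet> comm x y a)"
    by (simp add: comm_derivation comm_add algebra_simps)
  then have "comm x y (comm x y (z \<bullet> a))
      = (comm x y z \<bullet> comm x y a + comm x y z \<bullet> comm x y a) - comm x y (comm x y (z \<bullet> a))"
    by (simp add: comm_square_antiderivation)
  then show "comm x y z \<bullet> comm x y a + comm x y z \<bullet> comm x y a
      = comm x y (comm x y (z \<bullet> a)) + comm x y (comm x y (z \<bullet> a))"
    unfolding eq_diff_eq by simp
qed

text \<open>\<open>D\<^sup>3\<close> anticommutes with every multiplication: \<open>D\<^sup>3(za)\<close> is \<open>D\<close> applied to \<open>(Dz)(Da)\<close>, and the two
  terms that arise collapse by the identities for \<open>D\<^sup>2\<close>.\<close>

lemma comm_cube_mult: "comm x y (comm x y (comm x y (z \<bullet> a))) = - (z \<bullet> comm x y (comm x y (comm x y a)))"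
proof -
  have "comm x y (comm x y (comm x y (z \<bullet> a))) = comm x y (comm x y z \<bullet> comm x y a)"
    by (simp add: comm_pair)
  also have "\<dots> = comm x y (comm x y z) \<bullet> comm x y a + comm x y (comm x y (z \<bullet> comm x y a))"
    by (simp add: comm_derivation[of x y "comm x y z" "comm x y a"] comm_pair[of x y z "comm x y a"])
  finally show ?thesis
    using comm_square_antiderivation[of x y z "comm x y a"] by (simp add: eq_neg_iff_add_eq_0 add.assoc add.commute add.left_commute)
qed

text \<open>Multiplication by \<open>ab\<close> is a quadratic expression in the multiplications by \<open>a\<close> and \<open>b\<close>, so it
  commutes with \<open>D\<^sup>3\<close>; being a multiplication, it anticommutes with \<open>D\<^sup>3\<close> as well.\<close>

lemma comm_cube_triple_product: "comm x y (comm x y (comm x y (a \<bullet> b \<bullet> c))) = 0"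
proof (rule double_zero_imp_zero)
  let ?K = "\<lambda>z. comm x y (comm x y (comm x y z))"
  have "?K (a \<bullet> b \<bullet> c) = a \<bullet> (b \<bullet> ?K c) + b \<bullet> (a \<bullet> ?K c)"
    unfolding comm_cube_mult[of x y "a \<bullet> b" c] by (simp add: product_mult)
  moreover have "?K (a \<bullet> b \<bullet> c) = - (a \<bullet> (b \<bullet> ?K c) + b \<bullet> (a \<bullet> ?K c))"
    unfolding product_mult[of a b c] by (simp add: comm_cube_mult comm_diff comm_minus)
  ultimately show "?K (a \<bullet> b \<bullet> c) + ?K (a \<bullet> b \<bullet> c) = 0"
    by (metis add.right_inverse)
qed

text \<open>\<open>D\<^sup>3 = 6 XXYYXY\<close>: after \<open>D\<^sup>2\<close> is written as \<open>3 (XYXY + YXYX)\<close>, the alternating words of length six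
  vanish and the other two words are \<open>XXYYXY\<close> up to sign.\<close>

lemma comm_cube:
  assumes w_def: "w = x \<bullet> (x \<bullet> (y \<bullet> (y \<bullet> (x \<bullet> (y \<bullet> z)))))"
  shows "comm x y (comm x y (comm x y z)) = (w + w + w) + (w + w + w)"
proof -
  have 1: "x \<bullet> (y \<bullet> (x \<bullet> (y \<bullet> (x \<bullet> (y \<bullet> z))))) = 0"
    by (simp add: words_2_2(1)[where x = x and y = y, symmetric] mult_cube_zero)
  have 2: "y \<bullet> (x \<bullet> (y \<bullet> (x \<bullet> (y \<bullet> (x \<bullet> z))))) = 0"
    by (simp add: words_2_2(1)[where x = y and y = x, symmetric] mult_cube_zero)
  have a: "y \<bullet> (x \<bullet> (x \<bullet> (y \<bullet> (x \<bullet> (y \<bullet> z))))) = - w"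
    using mult_cube_polar[of x y "y \<bullet> (x \<bullet> (y \<bullet> z))"] 1 w_def by (simp add: eq_neg_iff_add_eq_0 add.commute)
  have "y \<bullet> (y \<bullet> (x \<bullet> (y \<bullet> z))) = - (y \<bullet> (x \<bullet> (y \<bullet> (y \<bullet> z))))"
    using mult_cube_polar[of y x "y \<bullet> z"] by (simp add: eq_neg_iff_add_eq_0 mult_cube_zero)
  then have "w = - (x \<bullet> (x \<bullet> (y \<bullet> (x \<bullet> (y \<bullet> (y \<bullet> z))))))"
    by (simp add: w_def)
  also have "\<dots> = x \<bullet> (y \<bullet> (x \<bullet> (x \<bullet> (y \<bullet> (y \<bullet> z)))))"
    using mult_cube_polar[of x y "x \<bullet> (y \<bullet> (y \<bullet> z))"] by (simp add: neg_eq_iff_add_eq_0 mult_cube_zero)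
  also have "\<dots> = x \<bullet> (y \<bullet> (y \<bullet> (x \<bullet> (y \<bullet> (x \<bullet> z)))))"
    by (simp add: words_2_2(1)[where x = y and y = x])
  finally have b: "x \<bullet> (y \<bullet> (y \<bullet> (x \<bullet> (y \<bullet> (x \<bullet> z))))) = w" ..
  have "x \<bullet> (y \<bullet> (comm x y (comm x y z))) = w + w + w"
    unfolding comm_square_words by (simp add: mult_linear 1 b)
  moreover have "y \<bullet> (x \<bullet> (comm x y (comm x y z))) = - w - w - w"
    unfolding comm_square_words by (simp add: mult_linear 2 a)
  moreover have "comm x y (comm x y (comm x y z)) = x \<bullet> (y \<bullet> (comm x y (comm x y z))) - y \<bullet> (x \<bullet> (comm x y (comm x y z)))"
    by (simp add: comm_def)
  ultimately have "comm x y (comm x y (comm x y z)) = (w + w + w) - (- w - w - w)" by simp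
  then show ?thesis by simp
qed

lemma word_triple_product: "x \<bullet> (x \<bullet> (y \<bullet> (y \<bullet> (x \<bullet> (y \<bullet> (a \<bullet> b \<bullet> c)))))) = 0"
proof -
  let ?w = "x \<bullet> (x \<bullet> (y \<bullet> (y \<bullet> (x \<bullet> (y \<bullet> (a \<bullet> b \<bullet> c))))))"
  have "(?w + ?w + ?w) + (?w + ?w + ?w) = 0"
    by (rule trans[OF comm_cube[OF refl, symmetric] comm_cube_triple_product])
  then show ?thesis
    by (rule triple_zero_imp_zero[OF double_zero_imp_zero])
qed

section \<open>Idempotent subspaces vanish\<close>

definition product_span :: "'n set \<Rightarrow> 'n set \<Rightarrow> 'n set" where
  "product_span I J = span {x \<bullet> y | x y. x \<in> I \<and> y \<in> J}"

lemma subspace_product_span: "subspace (product_span I J)"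
  by (simp add: product_span_def)

lemma mult_mem_product_span: "x \<in> I \<Longrightarrow> y \<in> J \<Longrightarrow> x \<bullet> y \<in> product_span I J"
  unfolding product_span_def by (rule span_base) blast

lemma product_span_subset:
  "subspace S \<Longrightarrow> (\<And>x y. x \<in> I \<Longrightarrow> y \<in> J \<Longrightarrow> x \<bullet> y \<in> S) \<Longrightarrow> product_span I J \<subseteq> S"
  unfolding product_span_def by (rule span_minimal) auto

lemma subspace_half: "subspace S \<Longrightarrow> v + v \<in> S \<Longrightarrow> v \<in> S"
proof -
  assume "subspace S" "v + v \<in> S"
  then have "scale (1 / 2) (v + v) \<in> S" by (simp add: subspace_def)
  moreover have "scale (1 / 2) (v + v) = v"
    using two_nonzero scale_left_distrib[of "1 / 2" "1 / 2" v]
    by (simp add: scale_right_distrib flip: add_divide_distrib)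
  ultimately show "v \<in> S" by simp
qed

lemma product_span_subset_of_squares:
  assumes "subspace S" "subspace I" "\<And>z. z \<in> I \<Longrightarrow> z \<bullet> z \<in> S"
  shows "product_span I I \<subseteq> S"
proof (rule product_span_subset[OF assms(1)])
  fix x y assume "x \<in> I" "y \<in> I"
  then have "(x + y) \<bullet> (x + y) - x \<bullet> x - y \<bullet> y \<in> S"
    using assms by (intro subspace_diff) (auto intro: subspace_add)
  then have "x \<bullet> y + x \<bullet> y \<in> S"
    by (simp add: mult_linear mult_commute[of y x] algebra_simps)
  then show "x \<bullet> y \<in> S" by (rule subspace_half[OF assms(1)])
qed

text \<open>Both sides are, up to a factor, the product of \<open>m\<^sup>2\<close> and \<open>y\<^sup>2\<close>, written in the two possible orders.\<close>

lemma square_sandwich: "m \<bullet> (y \<bullet> (y \<bullet> m)) + m \<bullet> (y \<bullet> (y \<bullet> m)) = - (y \<bullet> (y \<bullet> (m \<bullet> m)))"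
proof (rule double_cancel)
  have "m \<bullet> (y \<bullet> (y \<bullet> m)) + m \<bullet> (y \<bullet> (y \<bullet> m)) = - (m \<bullet> (m \<bullet> (y \<bullet> y)))"
    using arg_cong[OF square_mult[of y m], of "\<lambda>t. m \<bullet> t"]
    by (simp add: mult_linear mult_commute[of "y \<bullet> y" m])
  then have "(m \<bullet> (y \<bullet> (y \<bullet> m)) + m \<bullet> (y \<bullet> (y \<bullet> m))) + (m \<bullet> (y \<bullet> (y \<bullet> m)) + m \<bullet> (y \<bullet> (y \<bullet> m))) = m \<bullet> m \<bullet> (y \<bullet> y)"
    by (simp add: square_mult)
  also have "\<dots> = y \<bullet> y \<bullet> (m \<bullet> m)" by (rule mult_commute)
  also have "\<dots> = - (y \<bullet> (y \<bullet> (m \<bullet> m))) + - (y \<bullet> (y \<bullet> (m \<bullet> m)))"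
    by (simp add: square_mult)
  finally show "m \<bullet> (y \<bullet> (y \<bullet> m)) + m \<bullet> (y \<bullet> (y \<bullet> m)) + (m \<bullet> (y \<bullet> (y \<bullet> m)) + m \<bullet> (y \<bullet> (y \<bullet> m)))
    = - (y \<bullet> (y \<bullet> (m \<bullet> m))) + - (y \<bullet> (y \<bullet> (m \<bullet> m)))" .
qed

lemma idempotent_kills_xxyyxy:
  assumes idem: "I \<subseteq> product_span I I" and "d \<in> I"
  shows "x \<bullet> (x \<bullet> (y \<bullet> (y \<bullet> (x \<bullet> (y \<bullet> d))))) = 0"
proof -
  let ?S = "{d. x \<bullet> (x \<bullet> (y \<bullet> (y \<bullet> (x \<bullet> (y \<bullet> d))))) = 0}"
  have "u \<bullet> v \<in> ?S" if "u \<in> I" for u v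
  proof -
    have "product_span I I \<subseteq> {u. u \<bullet> v \<in> ?S}"
      by (rule product_span_subset)
        (auto simp: subspace_def mult_linear mult_scale_left mult_scale_right word_triple_product)
    then show ?thesis using idem that by blast
  qed
  then have "product_span I I \<subseteq> ?S"
    by (intro product_span_subset) (auto simp: subspace_def mult_linear mult_scale_right)
  then show ?thesis using assms by blast
qed

text \<open>Replace one letter \<open>y\<close> of the word \<open>XXYYXY\<close> by the element \<open>z\<close> to which the word is applied. The
  innermost position gives the word \<open>XXYYX\<close> applied to \<open>z\<^sup>2\<close>. The two others combine, by the Jacobi
  identity, to \<open>XX\<close> applied to \<open>m(xm)\<close> with \<open>m = yz\<close>, which is a multiple of \<open>XXX\<close> applied to \<open>m\<^sup>2\<close>.\<close>

lemma idempotent_kills_xxyyx: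
  assumes idem: "I \<subseteq> product_span I I" and I: "subspace I" and "d \<in> I"
  shows "x \<bullet> (x \<bullet> (y \<bullet> (y \<bullet> (x \<bullet> d)))) = 0"
proof -
  have "x \<bullet> (x \<bullet> (y \<bullet> (y \<bullet> (x \<bullet> (z \<bullet> z))))) = 0" if z: "z \<in> I" for z
  proof -
    define m where "m = y \<bullet> z"
    let ?f = "\<lambda>y. x \<bullet> (x \<bullet> (y \<bullet> (y \<bullet> (x \<bullet> (y \<bullet> z)))))"
    let ?t = "x \<bullet> (x \<bullet> (y \<bullet> (y \<bullet> (x \<bullet> (z \<bullet> z))))) + (x \<bullet> (x \<bullet> (y \<bullet> (z \<bullet> (x \<bullet> m)))) + x \<bullet> (x \<bullet> (z \<bullet> (y \<bullet> (x \<bullet> m)))))"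
    have f: "?f y = 0" for y by (rule idempotent_kills_xxyyxy[OF idem z])
    \<comment> \<open>\<open>?t\<close> is the part of \<open>?f (y + z)\<close> linear in the added letter \<open>z\<close>.\<close>
    have "?t + ?t = ?f (y + z) - ?f (y - z) - ?f z - ?f z"
      unfolding m_def by (simp add: mult_linear algebra_simps)
    also have "\<dots> = 0" by (simp only: f diff_self)
    finally have "?t = 0" by (rule double_zero_imp_zero)
    moreover have "x \<bullet> (x \<bullet> (y \<bullet> (z \<bullet> (x \<bullet> m)))) + x \<bullet> (x \<bullet> (z \<bullet> (y \<bullet> (x \<bullet> m)))) = - (x \<bullet> (x \<bullet> (m \<bullet> (x \<bullet> m))))"
      using arg_cong[OF product_mult[of y z "x \<bullet> m"], of "\<lambda>t. x \<bullet> (x \<bullet> t)"]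
      by (simp add: m_def mult_linear)
    moreover have "x \<bullet> (x \<bullet> (m \<bullet> (x \<bullet> m))) = 0"
    proof (rule double_zero_imp_zero)
      have "x \<bullet> (x \<bullet> (m \<bullet> (m \<bullet> x))) + x \<bullet> (x \<bullet> (m \<bullet> (m \<bullet> x))) = - (x \<bullet> (x \<bullet> (x \<bullet> (m \<bullet> m))))"
        using arg_cong[OF square_mult[of m x], of "\<lambda>t. x \<bullet> (x \<bullet> t)"]
        by (simp add: mult_linear mult_commute[of "m \<bullet> m" x])
      then show "x \<bullet> (x \<bullet> (m \<bullet> (x \<bullet> m))) + x \<bullet> (x \<bullet> (m \<bullet> (x \<bullet> m))) = 0"
        by (simp add: mult_cube_zero mult_commute[of x m])
    qed
    ultimately show ?thesis by simp
  qed
  then have "product_span I I \<subseteq> {d. x \<bullet> (x \<bullet> (y \<bullet> (y \<bullet> (x \<bullet> d)))) = 0}"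
    using I by (intro product_span_subset_of_squares) (auto simp: subspace_def mult_linear mult_scale_right)
  then show ?thesis using assms by blast
qed

text \<open>The same device with the letter \<open>x\<close> of \<open>XXYYX\<close> relates \<open>XXYY\<close> and \<open>YYXX\<close> on \<open>z\<^sup>2\<close> by a factor
  \<open>- 1/2\<close>. Exchanging \<open>x\<close> and \<open>y\<close> gives a second relation, and together they force both to vanish.\<close>

lemma idempotent_kills_xxyy:
  assumes idem: "I \<subseteq> product_span I I" and I: "subspace I" and "d \<in> I"
  shows "x \<bullet> (x \<bullet> (y \<bullet> (y \<bullet> d))) = 0"
proof -
  have "x \<bullet> (x \<bullet> (y \<bullet> (y \<bullet> (z \<bullet> z)))) = 0" if z: "z \<in> I" for z
  proof -
    let ?g = "\<lambda>x y. x \<bullet> (x \<bullet> (y \<bullet> (y \<bullet> (z \<bullet> z))))"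
    have rel: "?g x y + ?g x y = - ?g y x" for x y
    proof -
      define m where "m = x \<bullet> z"
      let ?f = "\<lambda>x. x \<bullet> (x \<bullet> (y \<bullet> (y \<bullet> (x \<bullet> z))))"
      let ?t = "?g x y + (x \<bullet> (z \<bullet> (y \<bullet> (y \<bullet> m))) + z \<bullet> (x \<bullet> (y \<bullet> (y \<bullet> m))))"
      have f: "?f x = 0" for x by (rule idempotent_kills_xxyyx[OF idem I z])
      have "?t + ?t = ?f (x + z) - ?f (x - z) - ?f z - ?f z"
        unfolding m_def by (simp add: mult_linear algebra_simps)
      also have "\<dots> = 0" by (simp only: f diff_self)
    finally have "?t = 0" by (rule double_zero_imp_zero)
      then have "?g x y = - (x \<bullet> (z \<bullet> (y \<bullet> (y \<bullet> m))) + z \<bullet> (x \<bullet> (y \<bullet> (y \<bullet> m))))"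
        by (simp only: eq_neg_iff_add_eq_0)
      also have "\<dots> = m \<bullet> (y \<bullet> (y \<bullet> m))"
        using product_mult[of x z "y \<bullet> (y \<bullet> m)"] by (simp add: m_def)
      finally have "?g x y + ?g x y = - (y \<bullet> (y \<bullet> (m \<bullet> m)))"
        using square_sandwich[of m y] by simp
      then show ?thesis by (simp add: m_def mult_pair)
    qed
    have "?g x y + ?g x y + ?g y x = 0" "?g y x + ?g y x + ?g x y = 0"
      using rel[of x y] rel[of y x] by simp_all
    then have "?g x y + (?g x y + ?g y x) = ?g y x + (?g x y + ?g y x)"
      by (simp add: add.assoc add.commute add.left_commute)
    then have "?g x y = ?g y x" by (rule add_right_imp_eq)
    with rel[of x y] have "?g x y + ?g x y + ?g x y = 0" by simp
    then show ?thesis by (rule triple_zero_imp_zero)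
  qed
  then have "product_span I I \<subseteq> {d. x \<bullet> (x \<bullet> (y \<bullet> (y \<bullet> d))) = 0}"
    using I by (intro product_span_subset_of_squares) (auto simp: subspace_def mult_linear mult_scale_right)
  then show ?thesis using assms by blast
qed

text \<open>\<open>XXYY\<close> is, up to a factor, the multiplication by \<open>y\<^sup>2\<close> followed by that by \<open>x\<^sup>2\<close>. Squares of elements
  of \<open>I\<close> span \<open>I\<close>, so \<open>I(II) = 0\<close>, and two substitutions of \<open>I\<close> for \<open>II\<close> leave \<open>I = 0\<close>.\<close>

lemma idempotent_subspace_zero:
  assumes idem: "I \<subseteq> product_span I I" and I: "subspace I"
  shows "I \<subseteq> {0}"
proof -
  have squares: "x \<bullet> x \<bullet> (y \<bullet> y \<bullet> d) = 0" if "d \<in> I" for x y d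
    using idempotent_kills_xxyy[OF idem I that, of x y] by (simp add: square_mult mult_linear)
  have "product_span I I \<subseteq> {u. u \<bullet> (y \<bullet> y \<bullet> d) = 0}" if "d \<in> I" for y d
    using I squares[OF that]
    by (intro product_span_subset_of_squares) (auto simp: subspace_def mult_linear mult_scale_left)
  with idem have one: "u \<bullet> (y \<bullet> y \<bullet> d) = 0" if "d \<in> I" "u \<in> I" for u y d
    using that by blast
  have "product_span I I \<subseteq> {v. u \<bullet> (v \<bullet> d) = 0}" if "d \<in> I" "u \<in> I" for u d
    using I one[OF that]
    by (intro product_span_subset_of_squares)
      (auto simp: subspace_def mult_linear mult_scale_left mult_scale_right)
  with idem have two: "u \<bullet> (v \<bullet> d) = 0" if "d \<in> I" "u \<in> I" "v \<in> I" for u v d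
    using that by blast
  have "product_span I I \<subseteq> {w. u \<bullet> w = 0}" if "u \<in> I" for u
    using that two by (intro product_span_subset) (auto simp: subspace_def mult_linear mult_scale_right)
  with idem have "u \<bullet> w = 0" if "u \<in> I" "w \<in> I" for u w
    using that by blast
  then have "product_span I I \<subseteq> {0}"
    by (intro product_span_subset) auto
  with idem show ?thesis by blast
qed

section \<open>Descending to an idempotent ideal\<close>

lemma algebra_ideal_product_span:
  assumes "algebra_ideal I" "algebra_ideal J"
  shows "algebra_ideal (product_span I J)"
proof -
  have "n \<bullet> w \<in> product_span I J" if "w \<in> product_span I J" for n w
  proof -
    have "n \<bullet> (x \<bullet> y) \<in> product_span I J" if "x \<in> I" "y \<in> J" for x y
      unfolding mult_product[of n x y]
      using assms that subspace_product_span
      by (intro subspace_diff subspace_neg mult_mem_product_span) (auto simp: algebra_ideal_def)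
    then have "product_span I J \<subseteq> {w. n \<bullet> w \<in> product_span I J}"
      using subspace_product_span[of I J]
      by (intro product_span_subset) (auto simp: subspace_def mult_linear mult_scale_right)
    with that show ?thesis by blast
  qed
  then show ?thesis
    by (auto simp: algebra_ideal_def subspace_product_span mult_commute)
qed

text \<open>The bottom terms of the finite flags of ideals in which each step is one-dimensional (or trivial)
  with square zero. They have finite codimension, and \<open>b\<^sup>2 \<in> H\<close> is what lets
  \<open>nil_flag_ideal_absorbs\<close> pass down a step.\<close>

inductive nil_flag_ideal :: "'n set \<Rightarrow> bool" where
  top: "nil_flag_ideal UNIV"
| step: "nil_flag_ideal Q \<Longrightarrow> algebra_ideal H \<Longrightarrow> Q = span (insert b H) \<Longrightarrow> b \<bullet> b \<in> H \<Longrightarrow> nil_flag_ideal H"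

lemma nil_flag_ideal_is_ideal: "nil_flag_ideal Q \<Longrightarrow> algebra_ideal Q"
  by (induction rule: nil_flag_ideal.induct) (auto simp: algebra_ideal_def)

lemma nil_flag_ideal_finite_codim: "nil_flag_ideal Q \<Longrightarrow> \<exists>F. finite F \<and> span (Q \<union> F) = UNIV"
proof (induction rule: nil_flag_ideal.induct)
  case top
  then show ?case by (intro exI[of _ "{}"]) auto
next
  case (step Q H b)
  then obtain F where F: "finite F" "span (Q \<union> F) = UNIV" by blast
  have "span (insert b H) \<subseteq> span (H \<union> insert b F)"
    by (rule span_mono) auto
  moreover have "F \<subseteq> span (H \<union> insert b F)"
    by (auto intro: span_base)
  ultimately have "span (Q \<union> F) \<subseteq> span (H \<union> insert b F)"
    using step.hyps by (intro span_minimal) auto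
  with F show ?case by (intro exI[of _ "insert b F"]) auto
qed

text \<open>In a step from \<open>Q = H + Kb\<close> to \<open>H\<close>, iterating \<open>I = IQ\<close> gives \<open>I = (IQ)Q\<close>. Terms with a factor
  from \<open>H\<close> lie in the ideal \<open>IH\<close>, and \<open>(xb)b\<close> is a multiple of \<open>x(b\<^sup>2)\<close>.\<close>

lemma nil_flag_ideal_absorbs:
  assumes "nil_flag_ideal Q" and I: "algebra_ideal I" and "I \<subseteq> product_span I UNIV"
  shows "I \<subseteq> product_span I Q"
  using assms(1)
proof (induction rule: nil_flag_ideal.induct)
  case top
  show ?case by fact
next
  case (step Q H b)
  let ?P = "product_span I H"
  have H: "algebra_ideal H" by fact
  have P: "algebra_ideal ?P" by (rule algebra_ideal_product_span[OF I H])
  then have sub: "subspace ?P" by (simp add: algebra_ideal_def)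
  have Q: "\<exists>k p. p \<in> H \<and> c = p + scale k b" if "c \<in> Q" for c
  proof -
    from that step.hyps obtain k where "c - scale k b \<in> span H" by (auto simp: span_insert)
    moreover have "span H = H" using H by (simp add: algebra_ideal_def span_eq_iff)
    ultimately show ?thesis by (intro exI[of _ k] exI[of _ "c - scale k b"]) simp
  qed
  have bb: "x \<bullet> b \<bullet> b \<in> ?P" if "x \<in> I" for x
  proof (rule subspace_half[OF sub])
    have "x \<bullet> b \<bullet> b + x \<bullet> b \<bullet> b = - (x \<bullet> (b \<bullet> b))"
      by (simp add: mult_commute[of x b] mult_commute[of "b \<bullet> x" b] mult_commute[of x "b \<bullet> b"] square_mult)
    then show "x \<bullet> b \<bullet> b + x \<bullet> b \<bullet> b \<in> ?P"
      using sub that step.hyps by (simp add: subspace_neg mult_mem_product_span)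
  qed
  have two: "x \<bullet> c \<bullet> d \<in> ?P" if x: "x \<in> I" and c: "c \<in> Q" and d: "d \<in> Q" for x c d
  proof -
    obtain k p where p: "p \<in> H" "c = p + scale k b" using Q[OF c] by blast
    obtain l q where q: "q \<in> H" "d = q + scale l b" using Q[OF d] by blast
    have 1: "x \<bullet> p \<bullet> d \<in> ?P"
      using mult_mem_product_span[OF x p(1)] P by (auto simp: algebra_ideal_def)
    have 2: "x \<bullet> b \<bullet> q \<in> ?P"
      using x q(1) I by (intro mult_mem_product_span) (auto simp: algebra_ideal_def)
    have "x \<bullet> c \<bullet> d = x \<bullet> p \<bullet> d + scale k (x \<bullet> b \<bullet> q + scale l (x \<bullet> b \<bullet> b))"
      by (simp add: p q mult_linear mult_scale_left mult_scale_right scale_right_distrib)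
    then show ?thesis
      using 1 2 bb[OF x] sub by (simp add: subspace_def)
  qed
  have "x \<bullet> d \<in> ?P" if x: "x \<in> I" and d: "d \<in> Q" for x d
  proof -
    have "product_span I Q \<subseteq> {x. x \<bullet> d \<in> ?P}"
      using sub two d by (intro product_span_subset) (auto simp: subspace_def mult_linear mult_scale_left)
    with step.IH x show ?thesis by blast
  qed
  then have "product_span I Q \<subseteq> ?P" by (intro product_span_subset sub)
  with step.IH show ?case by blast
qed

text \<open>A minimal \<open>nil_flag_ideal\<close> \<open>I\<close> equals \<open>IN\<close>: otherwise a hyperplane of \<open>I\<close> containing \<open>IN\<close> would be a
  smaller one, as every subspace between \<open>IN\<close> and \<open>I\<close> is an ideal containing all squares from \<open>I\<close>.\<close>

lemma dcc_imp_finite_span: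
  assumes dcc_ideals
  shows "\<exists>F. finite F \<and> span F = UNIV"
proof -
  obtain I where I: "nil_flag_ideal I" and min: "\<And>J. nil_flag_ideal J \<Longrightarrow> \<not> J \<subset> I"
    using dcc_minimal[OF assms, of nil_flag_ideal] nil_flag_ideal.top nil_flag_ideal_is_ideal by blast
  have ideal: "algebra_ideal I" using I by (rule nil_flag_ideal_is_ideal)
  let ?S = "product_span I UNIV"
  have "?S \<subseteq> I"
    using ideal by (intro product_span_subset) (auto simp: algebra_ideal_def)
  have "I \<subseteq> ?S"
  proof
    fix b assume b: "b \<in> I"
    show "b \<in> ?S"
    proof (rule ccontr)
      assume "b \<notin> ?S"
      then obtain H where H: "subspace H" "?S \<subseteq> H" "H \<subset> I" "I = span (insert b H)"
        using hyperplane_avoiding[OF subspace_product_span _ \<open>?S \<subseteq> I\<close> b] ideal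
        by (auto simp: algebra_ideal_def)
      have H_mult: "x \<bullet> y \<in> H" if "x \<in> I" for x y
        using mult_mem_product_span[OF that, of y UNIV] H(2) by blast
      have "x \<bullet> y \<in> H \<and> y \<bullet> x \<in> H" if "x \<in> H" for x y
        using that H(3) H_mult[of x y] by (subst (2) mult_commute) blast
      then have "algebra_ideal H"
        using H(1) by (auto simp: algebra_ideal_def)
      then have "nil_flag_ideal H" by (rule nil_flag_ideal.step[OF I _ H(4) H_mult[OF b]])
      with min H(3) show False by blast
    qed
  qed
  then have "I \<subseteq> product_span I I"
    by (rule nil_flag_ideal_absorbs[OF I ideal])
  then have "I \<subseteq> {0}"
    using ideal by (intro idempotent_subspace_zero) (auto simp: algebra_ideal_def)
  obtain F where F: "finite F" "span (I \<union> F) = UNIV"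
    using nil_flag_ideal_finite_codim[OF I] by blast
  have "span (I \<union> F) \<subseteq> span F"
    using \<open>I \<subseteq> {0}\<close> by (intro span_minimal) (auto simp: span_zero intro: span_base)
  with F show ?thesis by blast
qed

end

section \<open>Finite dimension\<close>

theorem corollary4p7:
  fixes scale :: "'k::field \<Rightarrow> 'n::ab_group_add \<Rightarrow> 'n"
    and mult :: "'n \<Rightarrow> 'n \<Rightarrow> 'n"
  assumes "infinite (UNIV :: 'k set)"
    and "CHAR('k) \<noteq> 2"
    and "CHAR('k) \<noteq> 3"
    and "commutative_nonassoc_algebra scale mult"
    and "\<And>x. mult (mult x x) x = 0"
    and "nonassoc_algebra.dcc_ideals scale mult"
  shows "\<exists>B. finite_dimensional_vector_space scale B"
proof -
  have "(of_nat p :: 'k) \<noteq> 0" if "prime p" "CHAR('k) \<noteq> p" for p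
    using that by (auto simp: of_nat_eq_0_iff_char_dvd prime_nat_iff)
  from this[of 2] this[of 3] assms(2,3) have "(2::'k) \<noteq> 0" "(3::'k) \<noteq> 0"
    by simp_all
  interpret commutative_nonassoc_algebra scale mult by fact
  interpret cubic_nil_algebra scale mult
    by unfold_locales (use assms(5) \<open>(2::'k) \<noteq> 0\<close> \<open>(3::'k) \<noteq> 0\<close> in auto)
  obtain F where F: "finite F" "span F = UNIV"
    using dcc_imp_finite_span assms(6) by blast
  obtain B where B: "B \<subseteq> F" "independent B" "F \<subseteq> span B"
    using maximal_independent_subset[of F] by blast
  have "span F \<subseteq> span B" using B(3) by (intro span_minimal) auto
  then have "finite_dimensional_vector_space scale B"
    using B F by unfold_locales (auto intro: finite_subset)
  then show ?thesis ..
qed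

end
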